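(* Let $\omega\in\mathbb{R}^d$ be nonresonant and $t_0\in\mathbb{R}$. For $\theta\in\mathbb{T}^d$ define $\kappa(\theta;t_0)=\Gamma(0,\theta;t_0\omega) \in \mathcal{G}$, with $\Gamma$ given by the recursions in the context. Let $\alpha(t;t_0)\in\mathcal{G}$ be the solution of $$\frac{\partial}{\partial t} \alpha(t;t_0) = \alpha(t;t_0) \star \beta(t),\qquad \alpha(t_0;t_0) = 1\!\!1,$$ where $\beta_{\mathbf{k}}(t)=e^{i\mathbf{k}\cdot\omega t}$ for each letter $\mathbf{k}\in\mathbb{Z}^d$ and $\beta_w(t)=0$ if the length of $w$ is not $1$. Then $$\alpha(t;t_0) = \bar\alpha(t;t_0)\star\kappa(t\omega;t_0),$$ where $\bar\alpha(t;t_0)$ satisfies the autonomous (averaged) initial value problem $$\frac{d}{dt} \bar \alpha(t;t_0) = \bar\alpha(t;t_0)\star \bar\beta(t_0),\qquad \bar\alpha(t_0;t_0) = 1\!\!1,$$ with $$\bar\beta(t_0) = \left. \frac{d}{dt} \bar\alpha(t;t_0)\right|_{t=t_0}\in\mathfrak{g}.$$ Furthermore, $\bar\alpha(t;t_0)$ may be found by means of $$\bar\alpha(t;t_0) = \Gamma(t-t_0, t_0\omega;t_0\omega).$$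
   Context: $\mathbb{T}^d=(\mathbb{R}/2\pi\mathbb{Z})^d$. $\mathcal{W}$ is the set of all words (including the empty word $\emptyset$) with letters in the alphabet $\mathbb{Z}^d$, and $\mathbb{C}^{\mathcal{W}}$ is the vector space of all maps $\delta:\mathcal{W}\to\mathbb{C}$, $w\mapsto\delta_w$. The convolution product on $\mathbb{C}^{\mathcal{W}}$ is $(\delta\star\delta')_\emptyset=\delta_\emptyset\delta'_\emptyset$, $(\delta\star\delta')_{\ell_1\cdots\ell_n}=\delta_\emptyset\delta'_{\ell_1\cdots\ell_n}+\sum_{j=1}^{n-1}\delta_{\ell_1\cdots\ell_j}\delta'_{\ell_{j+1}\cdots\ell_n}+\delta_{\ell_1\cdots\ell_n}\delta'_\emptyset$; its unit $1\!\!1$ has $1\!\!1_\emptyset=1$, $1\!\!1_w=0$ for $w\ne\emptyset$. Derivatives in $\mathbb{C}^{\mathcal{W}}$ are taken word by word. The shuffle product $w\sqcup\!\sqcup w'$ of two words is the formal sum $\sum_{j=1}^N w_j$ of all words formed by interleaving the letters of $w$ with those of $w'$ without altering the order in which the letters appear within $w$ or $w'$ (counted with multiplicity). $\mathcal{G}$ is the set (a group for $\star$) of $\gamma\in\mathbb{C}^{\mathcal{W}}$ with $\gamma_\emptyset=1$ and $\gamma_w\gamma_{w'}=\sum_{j}\gamma_{w_j}$ whenever $w\sqcup\!\sqcup w'=\sum_j w_j$. $\mathfrak{g}$ is the vector subspace of those $\beta\in\mathbb{C}^{\mathcal{W}}$ with $\beta_\emptyset=0$ and $\sum_j\beta_{w_j}=0$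 whenever $w,w'$ are nonempty words and $w\sqcup\!\sqcup w'=\sum_j w_j$. A vector $\omega\in\mathbb{R}^d$ is nonresonant if $\mathbf{k}\cdot\omega\neq 0$ for every $\mathbf{k}\in\mathbb{Z}^d\setminus\{\mathbf{0}\}$. Definition of $\Gamma(\tau,\theta;\theta_0)\in\mathbb{C}^{\mathcal{W}}$, $\tau\in\mathbb{R}$, $\theta,\theta_0\in\mathbb{T}^d$ (arguments omitted where unambiguous; $\mathbf{0}^r$ is the word of $r$ letters $\mathbf{0}$, and $(\mathbf{k}+\mathbf{l}_1)$ is a single letter): $\Gamma_\emptyset=1$ and, for $r\ge1$, $\mathbf{k}\in\mathbb{Z}^d\setminus\{\mathbf{0}\}$, $s\ge1$, $\mathbf{l}_1,\dots,\mathbf{l}_s\in\mathbb{Z}^d$: $\Gamma_{\mathbf{k}}=\frac{i}{\mathbf{k}\cdot\omega}(e^{i\mathbf{k}\cdot\theta_0}-e^{i\mathbf{k}\cdot\theta})$; $\Gamma_{\mathbf{0}^r}=\tau^r/r!$; $\Gamma_{\mathbf{0}^r\mathbf{k}}=\frac{i}{\mathbf{k}\cdot\omega}(\Gamma_{\mathbf{0}^{r-1}\mathbf{k}}-\Gamma_{\mathbf{0}^r}e^{i\mathbf{k}\cdot\theta})$; $\Gamma_{\mathbf{k}\mathbf{l}_1\cdots\mathbf{l}_s}=\frac{i}{\mathbf{k}\cdot\omega}(e^{i\mathbf{k}\cdot\theta_0}\Gamma_{\mathbf{l}_1\cdots\mathbf{l}_s}-\Gamma_{(\mathbf{k}+\mathbf{l}_1)\mathbf{l}_2\cdots\mathbf{l}_s})$;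 $\Gamma_{\mathbf{0}^r\mathbf{k}\mathbf{l}_1\cdots\mathbf{l}_s}=\frac{i}{\mathbf{k}\cdot\omega}(\Gamma_{\mathbf{0}^{r-1}\mathbf{k}\mathbf{l}_1\cdots\mathbf{l}_s}-\Gamma_{\mathbf{0}^r(\mathbf{k}+\mathbf{l}_1)\mathbf{l}_2\cdots\mathbf{l}_s})$. *)

theory Defs
  imports "HOL-Analysis.Analysis" "HOL-Library.Multiset"
begin

type_synonym 'a word_map = "'a list \<Rightarrow> complex"

text \<open>The summands \<open>j = 0\<close> and \<open>j = length w\<close> are the two terms that involve the value at the
  empty word; for \<open>w = []\<close> they coincide and are counted once.\<close>

definition conv :: "'a word_map \<Rightarrow> 'a word_map \<Rightarrow> 'a word_map"  (infixl "\<star>" 70) where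
  "\<delta> \<star> \<delta>' = (\<lambda>w. \<Sum>j\<le>length w. \<delta> (take j w) * \<delta>' (drop j w))"

definition conv_one :: "'a word_map" where
  "conv_one = (\<lambda>w. if w = [] then 1 else 0)"

text \<open>The library's \<open>shuffles\<close> is a set of words; the shuffle product has to record
  multiplicities.\<close>

fun shuffle_mset :: "'a list \<Rightarrow> 'a list \<Rightarrow> 'a list multiset" where
  "shuffle_mset [] ys = {#ys#}"
| "shuffle_mset xs [] = {#xs#}"
| "shuffle_mset (x # xs) (y # ys) =
     image_mset ((#) x) (shuffle_mset xs (y # ys)) + image_mset ((#) y) (shuffle_mset (x # xs) ys)"

lemma set_mset_shuffle_mset: "set_mset (shuffle_mset xs ys) = shuffles xs ys"
  by (induction xs ys rule: shuffle_mset.induct) auto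

lemma size_shuffle_mset:
  "size (shuffle_mset xs ys) = (length xs + length ys) choose length xs"
  by (induction xs ys rule: shuffle_mset.induct) auto

definition shuffle_group :: "'a word_map set" where
  "shuffle_group = {\<gamma>. \<gamma> [] = 1 \<and> (\<forall>w w'. \<gamma> w * \<gamma> w' = (\<Sum>u\<in>#shuffle_mset w w'. \<gamma> u))}"

definition shuffle_lie :: "'a word_map set" where
  "shuffle_lie = {\<beta>. \<beta> [] = 0 \<and>
     (\<forall>w w'. w \<noteq> [] \<longrightarrow> w' \<noteq> [] \<longrightarrow> (\<Sum>u\<in>#shuffle_mset w w'. \<beta> u) = 0)}"

definition has_word_derivative :: "(real \<Rightarrow> 'a word_map) \<Rightarrow> 'a word_map \<Rightarrow> real \<Rightarrow> bool" where
  "has_word_derivative a D t \<longleftrightarrow> (\<forall>w. ((\<lambda>s. a s w) has_vector_derivative D w) (at t))"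

definition solves_ivp :: "(real \<Rightarrow> 'a word_map) \<Rightarrow> real \<Rightarrow> (real \<Rightarrow> 'a word_map) \<Rightarrow> bool" where
  "solves_ivp b t\<^sub>0 a \<longleftrightarrow>
     a t\<^sub>0 = conv_one \<and> (\<forall>t. has_word_derivative a (a t \<star> b t) t)"

definition int_dot :: "int ^ 'd \<Rightarrow> real ^ 'd \<Rightarrow> real" where
  "int_dot k x = (\<Sum>i\<in>UNIV. real_of_int (k $ i) * x $ i)"

definition nonresonant :: "real ^ 'd \<Rightarrow> bool" where
  "nonresonant \<omega> \<longleftrightarrow> (\<forall>k. k \<noteq> 0 \<longrightarrow> int_dot k \<omega> \<noteq> 0)"

definition torus_rel :: "real ^ 'd \<Rightarrow> real ^ 'd \<Rightarrow> bool" where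
  "torus_rel x y \<longleftrightarrow> (\<exists>m :: int ^ 'd. \<forall>i. x $ i - y $ i = 2 * pi * real_of_int (m $ i))"

lemma equivp_torus_rel: "equivp (torus_rel :: real ^ 'd \<Rightarrow> real ^ 'd \<Rightarrow> bool)"
proof (rule equivpI)
  show "reflp (torus_rel :: real ^ 'd \<Rightarrow> _)"
    unfolding reflp_def torus_rel_def by (auto intro: exI[of _ 0])
  show "symp (torus_rel :: real ^ 'd \<Rightarrow> _)"
  proof (rule sympI)
    fix x y :: "real ^ 'd" assume "torus_rel x y"
    then obtain m :: "int ^ 'd" where m: "\<And>i. x $ i - y $ i = 2 * pi * real_of_int (m $ i)"
      unfolding torus_rel_def by blast
    have "y $ i - x $ i = 2 * pi * real_of_int ((- m) $ i)" for i
      using m[of i] by simp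
    then show "torus_rel y x" unfolding torus_rel_def by blast
  qed
  show "transp (torus_rel :: real ^ 'd \<Rightarrow> _)"
  proof (rule transpI)
    fix x y z :: "real ^ 'd" assume "torus_rel x y" "torus_rel y z"
    then obtain m n :: "int ^ 'd"
      where m: "\<And>i. x $ i - y $ i = 2 * pi * real_of_int (m $ i)"
        and n: "\<And>i. y $ i - z $ i = 2 * pi * real_of_int (n $ i)"
      unfolding torus_rel_def by blast
    have "x $ i - z $ i = 2 * pi * real_of_int ((m + n) $ i)" for i
      using m[of i] n[of i] by (simp add: algebra_simps)
    then show "torus_rel x z" unfolding torus_rel_def by blast
  qed
qed

quotient_type 'd torus = "real ^ 'd::finite" / torus_rel
  by (rule equivp_torus_rel)

lift_definition to_torus :: "real ^ 'd \<Rightarrow> 'd::finite torus" is "\<lambda>x. x" .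

lift_definition torus_exp :: "int ^ 'd \<Rightarrow> 'd::finite torus \<Rightarrow> complex"
  is "\<lambda>k x. exp (\<i> * complex_of_real (int_dot k x))"
proof -
  fix k :: "int ^ 'd" and x y :: "real ^ 'd"
  assume "torus_rel x y"
  then obtain m :: "int ^ 'd" where m: "\<And>i. x $ i - y $ i = 2 * pi * real_of_int (m $ i)"
    unfolding torus_rel_def by blast
  have "int_dot k x - int_dot k y = (\<Sum>i\<in>UNIV. real_of_int (k $ i) * (x $ i - y $ i))"
    by (simp add: int_dot_def sum_subtractf algebra_simps)
  also have "\<dots> = 2 * pi * real_of_int (\<Sum>i\<in>UNIV. k $ i * m $ i)"
    by (simp add: m sum_distrib_left mult_ac)
  finally have "int_dot k x = int_dot k y + 2 * pi * real_of_int (\<Sum>i\<in>UNIV. k $ i * m $ i)"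
    by simp
  then show "exp (\<i> * complex_of_real (int_dot k x)) = exp (\<i> * complex_of_real (int_dot k y))"
    unfolding exp_eq by (intro exI[of _ "\<Sum>i\<in>UNIV. k $ i * m $ i"]) (simp add: algebra_simps)
qed

lemma torus_exp_to_torus: "torus_exp k (to_torus x) = exp (\<i> * complex_of_real (int_dot k x))"
  by transfer simp

lemma word_cases_leading_zeros:
  fixes w :: "'a::zero list"
  obtains "w = []"
  | k where "k \<noteq> 0" "w = [k]"
  | r where "r \<ge> 1" "w = replicate r 0"
  | r k where "r \<ge> 1" "k \<noteq> 0" "w = replicate r 0 @ [k]"
  | k l ls where "k \<noteq> 0" "w = k # l # ls"
  | r k l ls where "r \<ge> 1" "k \<noteq> 0" "w = replicate r 0 @ k # l # ls"
proof -
  define u where "u = takeWhile (\<lambda>x. x = 0) w"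
  define v where "v = dropWhile (\<lambda>x. x = 0) w"
  have w: "w = u @ v" by (simp add: u_def v_def)
  have "\<forall>x\<in>set u. x = 0" unfolding u_def by (meson set_takeWhileD)
  then obtain n where u: "u = replicate n 0" by (metis replicate_eqI)
  have v0: "hd v \<noteq> 0" if "v \<noteq> []"
    using that hd_dropWhile[of "\<lambda>x. x = 0" w] unfolding v_def by blast
  show thesis
  proof (cases v)
    case Nil
    then have "w = replicate n 0" using w u by simp
    then show ?thesis using that(1) that(3)[of n] by (cases "n = 0") simp_all
  next
    case (Cons k vs)
    then have k: "k \<noteq> 0" using v0 by simp
    have w': "w = replicate n 0 @ k # vs" using w u Cons by simp
    show ?thesis
    proof (cases vs)
      case Nil
      then show ?thesis
        using k w' that(2)[of k] that(4)[of n k] by (cases "n = 0") simp_all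
    next
      case (Cons l ls)
      then show ?thesis
        using k w' that(5)[of k l ls] that(6)[of n k l ls] by (cases "n = 0") simp_all
    qed
  qed
qed

lemma leading_zeros_eq_iff:
  fixes k k' :: "'a::zero"
  assumes "k \<noteq> 0" "k' \<noteq> 0"
  shows "replicate r 0 @ k # ls = replicate r' 0 @ k' # ls' \<longleftrightarrow> r = r' \<and> k = k' \<and> ls = ls'"
  using assms
proof (induction r arbitrary: r')
  case 0
  then show ?case by (cases r') auto
next
  case (Suc r)
  then show ?case by (cases r') auto
qed

lemmas leading_zeros_Cons_eq_iff =
  leading_zeros_eq_iff[where r = 0, simplified] leading_zeros_eq_iff[where r' = 0, simplified]

lemma leading_zeros_neq:
  fixes k :: "'a::zero"
  assumes "k \<noteq> 0"
  shows "replicate r' 0 \<noteq> replicate r 0 @ k # ls" "replicate r 0 @ k # ls \<noteq> replicate r' 0"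
    "replicate r' 0 \<noteq> k # ls" "k # ls \<noteq> replicate r' 0"
  using assms by (metis in_set_conv_decomp in_set_replicate list.set_intros(1))+

context
  fixes \<omega> :: "real ^ 'd" and \<tau> :: real and \<theta> \<theta>\<^sub>0 :: "'d torus"
begin

function Gam :: "(int ^ 'd) word_map" where
  "Gam [] = 1"
| "k \<noteq> 0 \<Longrightarrow> Gam [k] =
     \<i> / complex_of_real (int_dot k \<omega>) * (torus_exp k \<theta>\<^sub>0 - torus_exp k \<theta>)"
| "r \<ge> 1 \<Longrightarrow> Gam (replicate r 0) = complex_of_real \<tau> ^ r / fact r"
| "r \<ge> 1 \<Longrightarrow> k \<noteq> 0 \<Longrightarrow> Gam (replicate r 0 @ [k]) =
     \<i> / complex_of_real (int_dot k \<omega>) *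
       (Gam (replicate (r - 1) 0 @ [k]) - Gam (replicate r 0) * torus_exp k \<theta>)"
| "k \<noteq> 0 \<Longrightarrow> Gam (k # l # ls) =
     \<i> / complex_of_real (int_dot k \<omega>) *
       (torus_exp k \<theta>\<^sub>0 * Gam (l # ls) - Gam ((k + l) # ls))"
| "r \<ge> 1 \<Longrightarrow> k \<noteq> 0 \<Longrightarrow> Gam (replicate r 0 @ k # l # ls) =
     \<i> / complex_of_real (int_dot k \<omega>) *
       (Gam (replicate (r - 1) 0 @ k # l # ls) - Gam (replicate r 0 @ (k + l) # ls))"
proof (goal_cases)
  case (1 P w)
  show ?case by (rule word_cases_leading_zeros[of w]) (fact 1)+
qed (simp_all add: leading_zeros_eq_iff leading_zeros_Cons_eq_iff leading_zeros_neq)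
termination by (relation "Wellfounded.measure length") auto

end

definition kappa :: "real ^ 'd \<Rightarrow> 'd::finite torus \<Rightarrow> real \<Rightarrow> (int ^ 'd) word_map" where
  "kappa \<omega> \<theta> t\<^sub>0 = Gam \<omega> 0 \<theta> (to_torus (t\<^sub>0 *\<^sub>R \<omega>))"

definition beta :: "real ^ 'd \<Rightarrow> real \<Rightarrow> (int ^ 'd) word_map" where
  "beta \<omega> t w = (case w of [k] \<Rightarrow> exp (\<i> * complex_of_real (int_dot k \<omega> * t)) | _ \<Rightarrow> 0)"

end

theory Submission imports Defs begin

text \<open>The recursions for \<open>\<Gamma>\<close> solve, word by word, the transport equation
  \<open>(\<partial>\<^sub>\<tau> + \<omega> \<cdot> \<nabla>\<^sub>\<theta>) \<Gamma> = \<Gamma> \<star> B(\<theta>)\<close>, where \<open>B(\<theta>)\<close>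
  has the value \<open>exp (\<i> k \<cdot> \<theta>)\<close> at the letter \<open>k\<close> and vanishes on all other words, with
  \<open>\<Gamma> = 1\<close> at \<open>\<tau> = 0\<close>, \<open>\<theta> = \<theta>\<^sub>0 = t\<^sub>0 \<omega>\<close>. Along the characteristic
  \<open>\<tau> = t - t\<^sub>0\<close>, \<open>\<theta> = t \<omega>\<close> this is the differential equation for \<open>\<alpha>\<close>
  (\<open>Gam_letter_flow\<close>), so \<open>\<alpha>(t) = \<Gamma>(t - t\<^sub>0, t \<omega>; \<theta>\<^sub>0)\<close>. Uniqueness is clear since the
  system is triangular in the length of words, and \<open>\<alpha>\<close> lies in the shuffle group since both sides
  of each shuffle relation have the same derivative and initial value (\<open>letter_flow_shuffle\<close>).

  The passage from this one line to all \<open>(\<tau>, \<theta>)\<close> uses nonresonance again, beyond making the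
  divisions by \<open>k \<cdot> \<omega>\<close> legitimate. Each
  \<open>\<Gamma>\<^sub>w\<close> is a finite sum of terms \<open>c \<tau>\<^sup>r exp (\<i> k \<cdot> \<theta>)\<close>. On the line these
  become, up to constants, terms \<open>(t - t\<^sub>0)\<^sup>r exp (\<i> (k \<cdot> \<omega>) t)\<close> whose
  frequencies differ for different \<open>k\<close>, and such functions are linearly
  independent. Hence every identity between such sums that holds on the line holds everywhere (\<open>exp_poly_zero_on_line\<close>).

  Two identities are extended in this way. The shuffle relations give
  \<open>\<Gamma>(\<tau>, \<theta>; \<theta>\<^sub>0) \<in> \<G>\<close> for all \<open>\<tau>\<close> and \<open>\<theta>\<close>. And
  \<open>\<Gamma>(\<sigma> + \<tau>, \<theta>; \<theta>\<^sub>0) = \<Gamma>(\<sigma>, \<theta>\<^sub>0; \<theta>\<^sub>0) \<star> \<Gamma>(\<tau>, \<theta>; \<theta>\<^sub>0)\<close>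
  (\<open>Gam_factor\<close>) holds since both sides solve the same equation along the line with the same value
  at \<open>t\<^sub>0\<close>. Taking \<open>\<tau> = 0\<close> yields the factorization of \<open>\<alpha>\<close> through \<open>\<kappa>\<close>. Taking
  \<open>\<theta> = \<theta>\<^sub>0\<close> shows that \<open>\<tau> \<mapsto> \<Gamma>(\<tau>, \<theta>\<^sub>0; \<theta>\<^sub>0)\<close> is a one-parameter subgroup of
  the shuffle group, so it satisfies an autonomous equation whose generator is its derivative at
  \<open>0\<close> and is therefore tangent to the group at the unit.\<close>

section \<open>Shuffles from the last letter\<close>

lemma shuffle_mset_Nil_right [simp]: "shuffle_mset xs [] = {#xs#}"
  by (cases xs) auto

lemma length_shuffle_mset: "u \<in># shuffle_mset xs ys \<Longrightarrow> length u = length xs + length ys"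
  by (simp add: set_mset_shuffle_mset length_shuffles)

text \<open>The shuffle product peels off first letters, whereas differentiation of a flow removes
  last letters; this recursion reconciles the two.\<close>

lemma shuffle_mset_snoc:
  "shuffle_mset (xs @ [a]) (ys @ [b]) =
     image_mset (\<lambda>u. u @ [a]) (shuffle_mset xs (ys @ [b])) +
     image_mset (\<lambda>u. u @ [b]) (shuffle_mset (xs @ [a]) ys)"
proof (induction xs ys rule: shuffle_mset.induct)
  case (1 ys)
  have *: "shuffle_mset [a] (ys @ [b]) =
      {#ys @ [b, a]#} + image_mset (\<lambda>u. u @ [b]) (shuffle_mset [a] ys)" for ys
    by (induction ys) (auto simp: multiset.map_comp comp_def)
  show ?case using *[of ys] by simp
next
  case (2 x xs)
  have *: "shuffle_mset (xs @ [a]) [b] =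
      image_mset (\<lambda>u. u @ [a]) (shuffle_mset xs [b]) + {#xs @ [a, b]#}" for xs
    by (induction xs) (auto simp: multiset.map_comp comp_def)
  show ?case using *[of "x # xs"] by simp
next
  case (3 x xs y ys)
  then show ?case by (simp add: multiset.map_comp comp_def)
qed

section \<open>Flows driven by single letters\<close>

lemma conv_one_right: "\<gamma> \<star> conv_one = \<gamma>"
proof
  fix w :: "'a list"
  have "\<gamma> (take j w) * conv_one (drop j w) = (if j = length w then \<gamma> w else 0)"
    if "j \<le> length w" for j
    using that unfolding conv_one_def by (cases "j = length w") simp_all
  then have "(\<gamma> \<star> conv_one) w = (\<Sum>j\<le>length w. if j = length w then \<gamma> w else 0)"
    unfolding conv_def by simp
  then show "(\<gamma> \<star> conv_one) w = \<gamma> w" by simp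
qed

lemma conv_one_left: "conv_one \<star> \<gamma> = \<gamma>"
proof
  fix w :: "'a list"
  have "conv_one (take j w) * \<gamma> (drop j w) = (if j = 0 then \<gamma> w else 0)"
    if "j \<le> length w" for j
    using that unfolding conv_one_def by (cases "j = 0") auto
  then have "(conv_one \<star> \<gamma>) w = (\<Sum>j\<le>length w. if j = 0 then \<gamma> w else 0)"
    unfolding conv_def by simp
  then show "(conv_one \<star> \<gamma>) w = \<gamma> w" by simp
qed

lemma conv_snoc:
  "(\<gamma> \<star> \<delta>) (w @ [k]) = (\<Sum>j\<le>length w. \<gamma> (take j w) * \<delta> (drop j w @ [k])) + \<gamma> (w @ [k]) * \<delta> []"
  by (simp add: conv_def)

lemma conv_letters_snoc:
  assumes "\<And>w. length w \<noteq> 1 \<Longrightarrow> \<delta> w = 0"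
  shows "(\<gamma> \<star> \<delta>) (w @ [k]) = \<gamma> w * \<delta> [k]"
proof -
  have "\<gamma> (take j w) * \<delta> (drop j w @ [k]) = (if j = length w then \<gamma> w * \<delta> [k] else 0)"
    if "j \<le> length w" for j
    using that assms[of "drop j w @ [k]"] by (cases "j = length w") simp_all
  then have "(\<Sum>j\<le>length w. \<gamma> (take j w) * \<delta> (drop j w @ [k])) =
      (\<Sum>j\<le>length w. if j = length w then \<gamma> w * \<delta> [k] else 0)"
    by simp
  then show ?thesis using assms[of "[]"] by (simp add: conv_snoc)
qed

text \<open>Word by word, an equation \<open>a' = a \<star> b\<close> whose \<open>b\<close> lives on single letters
  is triangular: the derivative at a word involves only the value at the word without its last
  letter. This is that system, in a form suited to induction from the right.\<close>

definition letter_flow :: "(real \<Rightarrow> 'a word_map) \<Rightarrow> (real \<Rightarrow> 'a word_map) \<Rightarrow> bool" where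
  "letter_flow b a \<longleftrightarrow> (\<forall>t. ((\<lambda>s. a s []) has_vector_derivative 0) (at t) \<and>
     (\<forall>w k. ((\<lambda>s. a s (w @ [k])) has_vector_derivative a t w * b t [k]) (at t)))"

lemma letter_flow_iff:
  assumes "\<And>t w. length w \<noteq> 1 \<Longrightarrow> b t w = 0"
  shows "letter_flow b a \<longleftrightarrow> (\<forall>t. has_word_derivative a (a t \<star> b t) t)"
proof -
  have nil: "(a t \<star> b t) [] = 0" for t using assms by (simp add: conv_def)
  have snoc: "(a t \<star> b t) (w @ [k]) = a t w * b t [k]" for t w k
    using assms by (rule conv_letters_snoc)
  show ?thesis
    unfolding letter_flow_def has_word_derivative_def
    by (metis nil snoc rev_exhaust)
qed

lemma constant_of_zero_vector_derivative:
  fixes f :: "real \<Rightarrow> complex"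
  assumes "\<And>t. (f has_vector_derivative 0) (at t)"
  shows "f t = f s"
proof -
  obtain c where "\<And>x. x \<in> UNIV \<Longrightarrow> f x = c"
    using has_vector_derivative_zero_constant[of UNIV f] assms by auto
  then show ?thesis by simp
qed

text \<open>The difference of two solutions has derivative zero at each word, once the solutions are
  known to agree at the word without its last letter.\<close>

lemma letter_flow_unique:
  assumes a: "letter_flow b a" and a': "letter_flow b a'" and init: "a t\<^sub>0 = a' t\<^sub>0"
  shows "a = a'"
proof -
  have "\<forall>t. a t w = a' t w" for w
  proof (induction w rule: rev_induct)
    case Nil
    have "((\<lambda>s. a s [] - a' s []) has_vector_derivative 0) (at t)" for t
      using a a' unfolding letter_flow_def by (auto intro!: derivative_eq_intros)
    from constant_of_zero_vector_derivative[OF this, of _ t\<^sub>0] show ?case using init by simp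
  next
    case (snoc k w)
    have "((\<lambda>s. a s (w @ [k]) - a' s (w @ [k])) has_vector_derivative
        (a t w * b t [k] - a' t w * b t [k])) (at t)" for t
      using a a' unfolding letter_flow_def by (auto intro!: has_vector_derivative_diff)
    then have "((\<lambda>s. a s (w @ [k]) - a' s (w @ [k])) has_vector_derivative 0) (at t)" for t
      using snoc.IH by simp
    from constant_of_zero_vector_derivative[OF this, of _ t\<^sub>0] show ?case using init by simp
  qed
  then show ?thesis by (intro ext) simp
qed

lemma has_vector_derivative_sum_mset:
  assumes "\<And>u. u \<in># M \<Longrightarrow> (f u has_vector_derivative f' u) (at (t::real))"
  shows "((\<lambda>s. \<Sum>u\<in>#M. f u s) has_vector_derivative (\<Sum>u\<in>#M. f' u)) (at t)"
  using assms by (induction M) (auto intro!: has_vector_derivative_add)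

text \<open>By the Leibniz rule the derivative of \<open>a t w * a t w'\<close> removes the last letter from one of
  the two words; by \<open>shuffle_mset_snoc\<close> so does the derivative of the sum over shuffles. Induction
  on the total length makes the two derivatives equal, and at \<open>t\<^sub>0\<close> both sides vanish unless one
  of the words is empty.\<close>

lemma letter_flow_shuffle:
  assumes flow: "letter_flow b a" and init: "a t\<^sub>0 = conv_one"
  shows "a t \<in> shuffle_group"
proof -
  have one: "a t [] = 1" for t
    using constant_of_zero_vector_derivative[of "\<lambda>s. a s []" t t\<^sub>0] flow init
    by (simp add: letter_flow_def conv_one_def)
  have d: "((\<lambda>s. a s (w @ [k])) has_vector_derivative a t w * b t [k]) (at t)" for w k t
    using flow by (simp add: letter_flow_def)
  have "\<forall>t. a t w * a t w' = (\<Sum>u\<in>#shuffle_mset w w'. a t u)" for w w'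
  proof (induction "length w + length w'" arbitrary: w w' rule: less_induct)
    case less
    show ?case
    proof (cases "w = [] \<or> w' = []")
      case True
      then show ?thesis by (auto simp: one)
    next
      case False
      then obtain v x v' x' where w: "w = v @ [x]" "w' = v' @ [x']"
        by (metis rev_exhaust)
      have IH1: "a t v * a t w' = (\<Sum>u\<in>#shuffle_mset v w'. a t u)" for t
        using less[of v w'] w by simp
      have IH2: "a t w * a t v' = (\<Sum>u\<in>#shuffle_mset w v'. a t u)" for t
        using less[of w v'] w by simp
      define M where "M = (\<lambda>s. \<Sum>u\<in>#shuffle_mset w w'. a s u)"
      have M: "M = (\<lambda>s. (\<Sum>u\<in>#shuffle_mset v w'. a s (u @ [x])) +
          (\<Sum>u\<in>#shuffle_mset w v'. a s (u @ [x'])))"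
        unfolding M_def w shuffle_mset_snoc by (simp add: multiset.map_comp comp_def)
      have "(M has_vector_derivative (\<Sum>u\<in>#shuffle_mset v w'. a t u * b t [x]) +
          (\<Sum>u\<in>#shuffle_mset w v'. a t u * b t [x'])) (at t)" for t
        unfolding M by (intro has_vector_derivative_add has_vector_derivative_sum_mset d)
      then have dM: "(M has_vector_derivative
          a t v * a t w' * b t [x] + a t w * a t v' * b t [x']) (at t)" for t
        by (simp add: IH1 IH2 sum_mset_distrib_right)
      have "((\<lambda>s. a s w * a s w') has_vector_derivative
          (a t w * (a t v' * b t [x']) + a t v * b t [x] * a t w')) (at t)" for t
        using has_vector_derivative_mult[OF d[where w=v and k=x] d[where w=v' and k=x']]
        by (simp add: w)
      from has_vector_derivative_diff[OF this dM]
      have "((\<lambda>s. a s w * a s w' - M s) has_vector_derivative 0) (at t)" for t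
        by (simp add: algebra_simps)
      from constant_of_zero_vector_derivative[OF this, of _ t\<^sub>0]
      have "a t w * a t w' - M t = a t\<^sub>0 w * a t\<^sub>0 w' - M t\<^sub>0" for t .
      moreover have "a t\<^sub>0 u = 0" if "u \<in># shuffle_mset w w'" for u
        using length_shuffle_mset[OF that] w by (auto simp: init conv_one_def)
      then have "M t\<^sub>0 = 0" unfolding M_def by (auto intro!: sum_mset.neutral)
      ultimately show ?thesis using w by (simp add: init conv_one_def M_def)
    qed
  qed
  then show ?thesis using one by (simp add: shuffle_group_def)
qed

section \<open>Linear independence of exponential polynomials\<close>

text \<open>The derivative has lower degree, so the leading coefficient of the sum is \<open>c\<close> times
  that of \<open>p\<close>.\<close>

lemma pderiv_add_smult_eq_0:
  fixes p :: "complex poly"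
  assumes "pderiv p + smult c p = 0" "c \<noteq> 0"
  shows "p = 0"
proof (rule ccontr)
  assume "p \<noteq> 0"
  have "coeff (pderiv p) (degree p) = 0" by (simp add: coeff_pderiv coeff_eq_0)
  with \<open>p \<noteq> 0\<close> assms(2) have "coeff (pderiv p + smult c p) (degree p) \<noteq> 0" by simp
  with assms(1) show False by simp
qed

lemma exp_poly_has_vector_derivative:
  "((\<lambda>s. poly p (of_real s) * exp (\<i> * of_real (\<mu> * s))) has_vector_derivative
     poly (pderiv p + smult (\<i> * of_real \<mu>) p) (of_real t) * exp (\<i> * of_real (\<mu> * t))) (at t)"
proof -
  have "((\<lambda>z. poly p z * exp (\<i> * (of_real \<mu> * z))) has_field_derivative
     poly (pderiv p + smult (\<i> * of_real \<mu>) p) (of_real t) * exp (\<i> * (of_real \<mu> * of_real t)))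
       (at (of_real t))"
    by (auto intro!: derivative_eq_intros poly_DERIV simp: algebra_simps)
  from has_vector_derivative_real_field[OF this] show ?thesis by simp
qed

text \<open>Dividing by one of the exponentials makes its frequency zero, so that differentiation
  lowers the degree of its coefficient, while by \<open>pderiv_add_smult_eq_0\<close> it acts injectively on the
  coefficients of the other exponentials. The induction is therefore on the set of frequencies and,
  inside it, on the degree of the coefficient of the frequency last added; once that coefficient is
  constant, differentiation removes its frequency.\<close>

lemma exp_poly_independent:
  fixes p :: "'k \<Rightarrow> complex poly"
  assumes "finite K" "inj_on \<mu> K"
    and "\<And>t::real. (\<Sum>k\<in>K. poly (p k) (of_real t) * exp (\<i> * of_real (\<mu> k * t))) = 0"
  shows "\<forall>k\<in>K. p k = 0"
  using assms
proof (induction K arbitrary: p rule: finite_induct)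
  case empty
  then show ?case by simp
next
  case (insert m K)
  have ne: "\<mu> k \<noteq> \<mu> m" if "k \<in> K" for k
    using that insert.hyps insert.prems(1) by (metis inj_on_contraD insertCI)
  show ?case using insert.prems(2)
  proof (induction "degree (p m)" arbitrary: p rule: less_induct)
    case less
    \<comment> \<open>the action of differentiation on the coefficients, after division by the exponential of \<open>m\<close>\<close>
    define L where "L = (\<lambda>k. pderiv (p k) + smult (\<i> * of_real (\<mu> k - \<mu> m)) (p k))"
    have shift: "(\<Sum>k\<in>insert m K. poly (q k) (of_real t) * exp (\<i> * of_real ((\<mu> k - \<mu> m) * t))) =
        exp (- \<i> * of_real (\<mu> m * t)) *
          (\<Sum>k\<in>insert m K. poly (q k) (of_real t) * exp (\<i> * of_real (\<mu> k * t)))"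
      for q :: "'k \<Rightarrow> complex poly" and t :: real
      unfolding sum_distrib_left
      by (intro sum.cong refl) (simp add: algebra_simps flip: exp_add)
    have deriv: "((\<lambda>s. \<Sum>k\<in>insert m K. poly (p k) (of_real s) * exp (\<i> * of_real ((\<mu> k - \<mu> m) * s)))
        has_vector_derivative
          (\<Sum>k\<in>insert m K. poly (L k) (of_real t) * exp (\<i> * of_real ((\<mu> k - \<mu> m) * t)))) (at t)"
      for t
      unfolding L_def by (intro has_vector_derivative_sum exp_poly_has_vector_derivative)
    have zero: "(\<lambda>s. \<Sum>k\<in>insert m K. poly (p k) (of_real s) * exp (\<i> * of_real ((\<mu> k - \<mu> m) * s)))
        = (\<lambda>s. 0)"
      unfolding shift less.prems by simp
    have
      "(\<Sum>k\<in>insert m K. poly (L k) (of_real t) * exp (\<i> * of_real ((\<mu> k - \<mu> m) * t))) = 0" for t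
      using deriv[of t] unfolding zero
      by (rule vector_derivative_unique_at[OF _ has_vector_derivative_const])
    then have Lsum: "(\<Sum>k\<in>insert m K. poly (L k) (of_real t) * exp (\<i> * of_real (\<mu> k * t))) = 0" for t
      unfolding shift by simp
    have Lm: "L m = pderiv (p m)" by (simp add: L_def)
    have L0: "\<forall>k\<in>insert m K. L k = 0"
    proof (cases "degree (p m) = 0")
      case True
      then have "L m = 0" by (simp add: Lm pderiv_eq_0_iff)
      moreover have "\<forall>k\<in>K. L k = 0"
      proof (rule insert.IH)
        show "inj_on \<mu> K" using insert.prems(1) by (rule inj_on_subset) auto
        show "(\<Sum>k\<in>K. poly (L k) (of_real t) * exp (\<i> * of_real (\<mu> k * t))) = 0" for t
          using Lsum[of t] \<open>L m = 0\<close> insert.hyps by simp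
      qed
      ultimately show ?thesis by simp
    next
      case False
      then show ?thesis using less.hyps[of L] Lsum by (simp add: Lm degree_pderiv)
    qed
    have pK: "p k = 0" if "k \<in> K" for k
    proof (rule pderiv_add_smult_eq_0)
      show "pderiv (p k) + smult (\<i> * of_real (\<mu> k - \<mu> m)) (p k) = 0"
        using L0 that by (simp add: L_def)
      show "\<i> * complex_of_real (\<mu> k - \<mu> m) \<noteq> 0" using ne[OF that] by simp
    qed
    have "degree (p m) = 0" using L0 by (simp add: Lm pderiv_eq_0_iff)
    then obtain c where c: "p m = [:c:]" by (metis degree_eq_zeroE)
    have "c = 0" using less.prems[of 0] pK insert.hyps by (simp add: c)
    then show ?case using pK c by simp
  qed
qed

section \<open>Exponential polynomials on the torus\<close>

lemma int_dot_0 [simp]: "int_dot 0 x = 0"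
  by (simp add: int_dot_def)

lemma int_dot_add: "int_dot (k + l) x = int_dot k x + int_dot l x"
  by (simp add: int_dot_def algebra_simps sum.distrib)

lemma int_dot_scaleR: "int_dot k (c *\<^sub>R x) = int_dot k x * c"
  by (simp add: int_dot_def sum_distrib_right mult.assoc mult.commute[of c])

lemma torus_exp_0 [simp]: "torus_exp 0 \<theta> = 1"
  by transfer simp

lemma torus_exp_add: "torus_exp (k + l) \<theta> = torus_exp k \<theta> * torus_exp l \<theta>"
  by transfer (simp add: int_dot_add algebra_simps exp_add)

lemma torus_exp_line:
  "torus_exp k (to_torus (t *\<^sub>R \<omega>)) = exp (\<i> * of_real (int_dot k \<omega> * t))"
  by (simp add: torus_exp_to_torus int_dot_scaleR)

lemma nonresonant_inj:
  assumes "nonresonant \<omega>"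
  shows "inj_on (\<lambda>k. int_dot k \<omega>) K"
proof (rule inj_onI)
  fix k l assume "int_dot k \<omega> = int_dot l \<omega>"
  then have "int_dot (k - l) \<omega> = 0" using int_dot_add[of "k - l" l \<omega>] by simp
  then have "k - l = 0" using assms unfolding nonresonant_def by blast
  then show "k = l" by simp
qed

text \<open>An inductive description rather than an explicit finite sum, since closure under products
  and shifts then needs no bookkeeping of index sets; \<open>exp_poly_normal_form\<close> recovers the sum.\<close>

inductive exp_poly :: "(real \<Rightarrow> 'd::finite torus \<Rightarrow> complex) \<Rightarrow> bool" where
  monomial: "exp_poly (\<lambda>\<tau> \<theta>. c * of_real \<tau> ^ r * torus_exp k \<theta>)"
| add: "exp_poly f \<Longrightarrow> exp_poly g \<Longrightarrow> exp_poly (\<lambda>\<tau> \<theta>. f \<tau> \<theta> + g \<tau> \<theta>)"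

lemma exp_poly_const: "exp_poly (\<lambda>\<tau> \<theta>. c)"
  using exp_poly.monomial[of c 0 0] by simp

lemma exp_poly_torus_exp: "exp_poly (\<lambda>\<tau> \<theta>. torus_exp k \<theta>)"
  using exp_poly.monomial[of 1 0 k] by simp

lemma exp_poly_time: "exp_poly (\<lambda>\<tau> \<theta>. of_real \<tau>)"
  using exp_poly.monomial[of 1 1 0] by simp

lemma exp_poly_mult:
  assumes "exp_poly f" "exp_poly g"
  shows "exp_poly (\<lambda>\<tau> \<theta>. f \<tau> \<theta> * g \<tau> \<theta>)"
  using assms(1)
proof induction
  case (monomial c r k)
  from assms(2) show ?case
  proof induction
    case (monomial c' r' k')
    from exp_poly.monomial[of "c * c'" "r + r'" "k + k'"] show ?case
      by (simp add: power_add torus_exp_add mult_ac)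
  next
    case (add f g)
    then show ?case by (simp add: distrib_left exp_poly.add)
  qed
next
  case (add f g)
  then show ?case by (simp add: distrib_right exp_poly.add)
qed

lemma exp_poly_diff: "exp_poly f \<Longrightarrow> exp_poly g \<Longrightarrow> exp_poly (\<lambda>\<tau> \<theta>. f \<tau> \<theta> - g \<tau> \<theta>)"
  using exp_poly.add[OF _ exp_poly_mult[OF exp_poly_const[of "-1"]], of f g] by simp

lemma exp_poly_power: "exp_poly f \<Longrightarrow> exp_poly (\<lambda>\<tau> \<theta>. f \<tau> \<theta> ^ n)"
  by (induction n) (auto intro: exp_poly_mult exp_poly_const)

lemma exp_poly_sum: "(\<And>x. x \<in> A \<Longrightarrow> exp_poly (f x)) \<Longrightarrow> exp_poly (\<lambda>\<tau> \<theta>. \<Sum>x\<in>A. f x \<tau> \<theta>)"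
  by (induction A rule: infinite_finite_induct) (auto intro: exp_poly.add exp_poly_const)

lemma exp_poly_sum_mset:
  "(\<And>x. x \<in># M \<Longrightarrow> exp_poly (f x)) \<Longrightarrow> exp_poly (\<lambda>\<tau> \<theta>. \<Sum>x\<in>#M. f x \<tau> \<theta>)"
  by (induction M) (auto intro: exp_poly.add exp_poly_const)

lemma exp_poly_shift: "exp_poly f \<Longrightarrow> exp_poly (\<lambda>\<tau> \<theta>. f (\<sigma> + \<tau>) \<theta>)"
proof (induction rule: exp_poly.induct)
  case (monomial c r k)
  show ?case
    unfolding of_real_add
    by (intro exp_poly_mult exp_poly_const exp_poly_torus_exp exp_poly_power exp_poly.add exp_poly_time)
next
  case (add f g)
  show ?case by (rule exp_poly.add[OF add.IH])
qed

lemma exp_poly_differentiable: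
  "exp_poly f \<Longrightarrow> (\<lambda>\<tau>. f \<tau> \<theta>) differentiable (at \<tau>)"
proof (induction rule: exp_poly.induct)
  case (monomial c r k)
  have "((\<lambda>\<tau>. c * of_real \<tau> ^ r * torus_exp k \<theta>) has_vector_derivative
      c * (of_nat r * of_real \<tau> ^ (r - 1)) * torus_exp k \<theta>) (at \<tau>)"
  proof -
    have "((\<lambda>z. c * z ^ r * torus_exp k \<theta>) has_field_derivative
        c * (of_nat r * of_real \<tau> ^ (r - 1)) * torus_exp k \<theta>) (at (of_real \<tau>))"
      by (auto intro!: derivative_eq_intros)
    from has_vector_derivative_real_field[OF this] show ?thesis .
  qed
  then show ?case by (rule differentiableI_vector)
next
  case (add f g)
  then show ?case by (intro differentiable_add)
qed

lemma exp_poly_normal_form: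
  assumes "exp_poly f"
  obtains K p where "finite K"
    "\<And>\<tau> \<theta>. f \<tau> \<theta> = (\<Sum>k\<in>K. poly (p k) (of_real \<tau>) * torus_exp k \<theta>)"
proof -
  have "\<exists>K p. finite K \<and> (\<forall>\<tau> \<theta>. f \<tau> \<theta> = (\<Sum>k\<in>K. poly (p k) (of_real \<tau>) * torus_exp k \<theta>))"
    using assms
  proof induction
    case (monomial c r k)
    show ?case by (rule exI[of _ "{k}"], rule exI[of _ "\<lambda>_. monom c r"]) (simp add: poly_monom)
  next
    case (add f g)
    then obtain K p K' p' where fin: "finite K" "finite K'"
      and f: "\<And>\<tau> \<theta>. f \<tau> \<theta> = (\<Sum>k\<in>K. poly (p k) (of_real \<tau>) * torus_exp k \<theta>)"
      and g: "\<And>\<tau> \<theta>. g \<tau> \<theta> = (\<Sum>k\<in>K'. poly (p' k) (of_real \<tau>) * torus_exp k \<theta>)"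
      by blast
    define q where "q = (\<lambda>k. (if k \<in> K then p k else 0) + (if k \<in> K' then p' k else 0))"
    have ext: "(\<Sum>k\<in>A. poly (h k) (of_real \<tau>) * torus_exp k \<theta>) =
        (\<Sum>k\<in>K \<union> K'. poly (if k \<in> A then h k else 0) (of_real \<tau>) * torus_exp k \<theta>)"
      if "A \<subseteq> K \<union> K'" for A h \<tau> \<theta>
      using that fin by (intro sum.mono_neutral_cong_left) auto
    have "f \<tau> \<theta> + g \<tau> \<theta> = (\<Sum>k\<in>K \<union> K'. poly (q k) (of_real \<tau>) * torus_exp k \<theta>)" for \<tau> \<theta>
      unfolding f g q_def poly_add distrib_right sum.distrib
      by (subst (1 2) ext) auto
    then show ?case using fin by blast
  qed
  then show thesis using that by blast
qed

text \<open>Nonresonance makes the frequencies \<open>k \<cdot> \<omega>\<close> pairwise different, so vanishing on the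
  line forces all coefficients to vanish.\<close>

lemma exp_poly_zero_on_line:
  assumes "nonresonant \<omega>" "exp_poly f" "\<And>t. f (t - t\<^sub>0) (to_torus (t *\<^sub>R \<omega>)) = 0"
  shows "f \<tau> \<theta> = 0"
proof -
  obtain K p where fin: "finite K"
    and f: "\<And>\<tau> \<theta>. f \<tau> \<theta> = (\<Sum>k\<in>K. poly (p k) (of_real \<tau>) * torus_exp k \<theta>)"
    using exp_poly_normal_form[OF assms(2)] by blast
  \<comment> \<open>the polynomials are in \<open>t - t\<^sub>0\<close>; measuring time from \<open>t\<^sub>0\<close> costs a phase factor per frequency\<close>
  define q where "q = (\<lambda>k. smult (exp (\<i> * of_real (int_dot k \<omega> * t\<^sub>0))) (p k))"
  have "(\<Sum>k\<in>K. poly (q k) (of_real s) * exp (\<i> * of_real (int_dot k \<omega> * s))) = 0" for s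
  proof -
    have "exp (\<i> * of_real (int_dot k \<omega> * (s + t\<^sub>0))) =
        exp (\<i> * of_real (int_dot k \<omega> * t\<^sub>0)) * exp (\<i> * of_real (int_dot k \<omega> * s))" for k
      by (simp add: algebra_simps flip: exp_add)
    then show ?thesis using assms(3)[of "s + t\<^sub>0"]
      by (simp add: f torus_exp_line q_def mult_ac)
  qed
  then have "\<forall>k\<in>K. q k = 0"
    by (rule exp_poly_independent[OF fin nonresonant_inj[OF assms(1)]])
  then show ?thesis by (simp add: f q_def)
qed

section \<open>The word maps \<open>\<Gamma>\<close>\<close>

lemma beta_nonletter: "length w \<noteq> 1 \<Longrightarrow> beta \<omega> t w = 0"
  by (auto simp: beta_def split: list.splits)

lemma beta_letter: "beta \<omega> t [k] = torus_exp k (to_torus (t *\<^sub>R \<omega>))"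
  by (simp add: beta_def torus_exp_line)

lemma Gam_exp_poly:
  fixes \<omega> :: "real ^ 'd"
  shows "exp_poly (\<lambda>\<tau> \<theta>. Gam \<omega> \<tau> \<theta> \<theta>\<^sub>0 w)"
proof (induction w rule: Gam.induct)
  case 1
  then show ?case by (simp add: exp_poly_const)
next
  case (2 k)
  show ?case unfolding Gam.simps(2)[OF 2]
    by (intro exp_poly_mult exp_poly_diff exp_poly_const exp_poly_torus_exp)
next
  case (3 r)
  have "exp_poly (\<lambda>\<tau> \<theta>. of_real \<tau> ^ r * (1 / fact r) :: complex)"
    by (intro exp_poly_mult exp_poly_power exp_poly_time exp_poly_const)
  then show ?case unfolding Gam.simps(3)[OF 3] by simp
next
  case (4 r k)
  show ?case unfolding Gam.simps(4)[OF 4(1,2)]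
    by (intro exp_poly_mult exp_poly_diff exp_poly_const exp_poly_torus_exp 4)
next
  case (5 k l ls)
  show ?case unfolding Gam.simps(5)[OF 5(1)]
    by (intro exp_poly_mult[OF exp_poly_const] exp_poly_diff 5)
next
  case (6 r k l ls)
  show ?case unfolding Gam.simps(6)[OF 6(1,2)]
    by (intro exp_poly_mult[OF exp_poly_const] exp_poly_diff 6)
qed

text \<open>At \<open>\<tau> = 0\<close> and \<open>\<theta> = \<theta>\<^sub>0\<close> the two terms of the first recursion cancel and the
  others involve only values at shorter nonempty words or at powers of the letter \<open>0\<close>, which
  vanish.\<close>

lemma Gam_initial:
  fixes \<omega> :: "real ^ 'd"
  shows "Gam \<omega> 0 \<theta>\<^sub>0 \<theta>\<^sub>0 = conv_one"
proof
  fix w show "Gam \<omega> 0 \<theta>\<^sub>0 \<theta>\<^sub>0 w = conv_one w"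
    by (induction w rule: Gam.induct) (simp_all add: conv_one_def)
qed

text \<open>The transport equation along a characteristic. The recursions come from integration by
  parts in the first nonzero letter, whereas the equation concerns the last letter. Apart from
  powers of the letter \<open>0\<close> and the words in which the two letters coincide, the recursion is linear and commutes with removing the last letter,
  so the claim is inherited from shorter or earlier words. For words \<open>k l\<close> and \<open>0\<dots>0 k l\<close> the merged
  letter \<open>k + l\<close> is itself the last one, and \<open>exp (\<i> (k + l) \<cdot> \<theta>)\<close> splits into a product.\<close>

lemma Gam_line_derivative:
  fixes \<omega> :: "real ^ 'd"
  assumes nr: "nonresonant \<omega>" and "w \<noteq> []"
  shows "((\<lambda>s. Gam \<omega> (\<sigma> + s) (to_torus (s *\<^sub>R \<omega>)) \<theta>\<^sub>0 w) has_vector_derivative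
    Gam \<omega> (\<sigma> + t) (to_torus (t *\<^sub>R \<omega>)) \<theta>\<^sub>0 (butlast w) *
      torus_exp (last w) (to_torus (t *\<^sub>R \<omega>))) (at t)"
proof -
  define G where "G = (\<lambda>w s. Gam \<omega> (\<sigma> + s) (to_torus (s *\<^sub>R \<omega>)) \<theta>\<^sub>0 w)"
  define e where "e = (\<lambda>k s. torus_exp k (to_torus (s *\<^sub>R \<omega>)))"
  define c where "c = (\<lambda>k. \<i> / complex_of_real (int_dot k \<omega>))"
  have e_add: "e (k + l) s = e k s * e l s" for k l s
    by (simp add: e_def torus_exp_add)
  have c_inv: "c k * (\<i> * of_real (int_dot k \<omega>)) = -1" if "k \<noteq> 0" for k
    using nr that by (simp add: c_def nonresonant_def)
  have de: "(e k has_vector_derivative \<i> * of_real (int_dot k \<omega>) * e k t) (at t)" for k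
    using exp_poly_has_vector_derivative[of 1 "int_dot k \<omega>" t]
    by (simp add: e_def torus_exp_line[abs_def] one_pCons)
  have G2: "G [k] = (\<lambda>s. c k * (torus_exp k \<theta>\<^sub>0 - e k s))" if "k \<noteq> 0" for k
    using that by (simp add: G_def e_def c_def fun_eq_iff)
  have G3: "G (replicate r 0) = (\<lambda>s. of_real (\<sigma> + s) ^ r / fact r)" for r
    by (cases "r = 0") (simp_all add: G_def fun_eq_iff)
  have G4: "G (replicate r 0 @ [k]) =
      (\<lambda>s. c k * (G (replicate (r - 1) 0 @ [k]) s - G (replicate r 0) s * e k s))"
    if "r \<ge> 1" "k \<noteq> 0" for r k
    using that by (simp add: G_def e_def c_def fun_eq_iff)
  have G5: "G (k # l # ls) = (\<lambda>s. c k * (torus_exp k \<theta>\<^sub>0 * G (l # ls) s - G ((k + l) # ls) s))"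
    if "k \<noteq> 0" for k l ls
    using that by (simp add: G_def c_def fun_eq_iff)
  have G6: "G (replicate r 0 @ k # l # ls) =
      (\<lambda>s. c k * (G (replicate (r - 1) 0 @ k # l # ls) s - G (replicate r 0 @ (k + l) # ls) s))"
    if "r \<ge> 1" "k \<noteq> 0" for r k l ls
    using that by (simp add: G_def c_def fun_eq_iff)
  have G0: "G [] = (\<lambda>s. 1)" by (simp add: G_def)
  note step = has_vector_derivative_mult_right has_vector_derivative_diff has_vector_derivative_const
  have dzeros: "(G (replicate r 0) has_vector_derivative G (replicate (r - 1) 0) t) (at t)"
    if "r \<ge> 1" for r
  proof -
    have "((\<lambda>z. (of_real \<sigma> + z) ^ r / fact r) has_field_derivative
        of_nat r * (of_real \<sigma> + of_real t) ^ (r - 1) / fact r) (at (of_real t))"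
      by (auto intro!: derivative_eq_intros)
    from has_vector_derivative_real_field[OF this]
    have "(G (replicate r 0) has_vector_derivative
        of_nat r * of_real (\<sigma> + t) ^ (r - 1) / fact r) (at t)"
      by (simp add: G3)
    moreover have "of_nat r * of_real (\<sigma> + t) ^ (r - 1) / fact r = G (replicate (r - 1) 0) t"
      using that by (cases r) (simp_all add: G3 del: of_nat_Suc)
    ultimately show ?thesis by simp
  qed
  have "w \<noteq> [] \<longrightarrow> (G w has_vector_derivative G (butlast w) t * e (last w) t) (at t)"
  proof (induction w rule: Gam.induct)
    case 1
    show ?case by simp
  next
    case (2 k)
    have "(G [k] has_vector_derivative c k * (0 - \<i> * of_real (int_dot k \<omega>) * e k t)) (at t)"
      unfolding G2[OF 2] by (intro step de)
    moreover have "c k * (0 - \<i> * of_real (int_dot k \<omega>) * e k t) = e k t"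
      using arg_cong[OF c_inv[OF 2], of "\<lambda>x. - (x * e k t)"] by (simp add: mult_ac)
    ultimately show ?case by (simp add: G0)
  next
    case (3 r)
    have "butlast (replicate r (0 :: int ^ 'd)) = replicate (r - 1) 0"
      by (simp add: butlast_conv_take)
    moreover have "last (replicate r (0 :: int ^ 'd)) = 0" using 3 by simp
    ultimately show ?case using dzeros[OF 3] by (simp add: e_def)
  next
    case (4 r k)
    have "(G (replicate (r - 1) 0 @ [k]) has_vector_derivative G (replicate (r - 1) 0) t * e k t) (at t)"
      using 4 by simp
    then have "(G (replicate r 0 @ [k]) has_vector_derivative
        c k * (G (replicate (r - 1) 0) t * e k t -
          (G (replicate r 0) t * (\<i> * of_real (int_dot k \<omega>) * e k t) +
           G (replicate (r - 1) 0) t * e k t))) (at t)"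
      unfolding G4[OF 4(1,2)] by (intro step has_vector_derivative_mult de dzeros 4)
    moreover have "c k * (G (replicate (r - 1) 0) t * e k t -
          (G (replicate r 0) t * (\<i> * of_real (int_dot k \<omega>) * e k t) +
           G (replicate (r - 1) 0) t * e k t)) = G (replicate r 0) t * e k t"
      using arg_cong[OF c_inv[OF 4(2)], of "\<lambda>x. - (x * (G (replicate r 0) t * e k t))"]
      by (simp add: algebra_simps)
    ultimately show ?case by simp
  next
    case (5 k l ls)
    have "(G (k # l # ls) has_vector_derivative c k *
        (torus_exp k \<theta>\<^sub>0 * (G (butlast (l # ls)) t * e (last (l # ls)) t) -
          G (butlast ((k + l) # ls)) t * e (last ((k + l) # ls)) t)) (at t)"
      unfolding G5[OF 5(1)] by (intro step 5[rule_format]) simp_all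
    also have "c k * (torus_exp k \<theta>\<^sub>0 * (G (butlast (l # ls)) t * e (last (l # ls)) t) -
          G (butlast ((k + l) # ls)) t * e (last ((k + l) # ls)) t) =
        G (butlast (k # l # ls)) t * e (last (k # l # ls)) t"
      using 5(1) by (cases "ls = []") (simp_all add: G0 G2 G5 e_add algebra_simps)
    finally show ?case by simp
  next
    case (6 r k l ls)
    have "(G (replicate r 0 @ k # l # ls) has_vector_derivative c k *
        (G (butlast (replicate (r - 1) 0 @ k # l # ls)) t *
            e (last (replicate (r - 1) 0 @ k # l # ls)) t -
          G (butlast (replicate r 0 @ (k + l) # ls)) t *
            e (last (replicate r 0 @ (k + l) # ls)) t)) (at t)"
      unfolding G6[OF 6(1,2)] by (intro step 6[rule_format]) simp_all
    also have "c k * (G (butlast (replicate (r - 1) 0 @ k # l # ls)) t *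
            e (last (replicate (r - 1) 0 @ k # l # ls)) t -
          G (butlast (replicate r 0 @ (k + l) # ls)) t *
            e (last (replicate r 0 @ (k + l) # ls)) t) =
        G (butlast (replicate r 0 @ k # l # ls)) t * e (last (replicate r 0 @ k # l # ls)) t"
      using 6(1,2) by (cases "ls = []") (simp_all add: butlast_append G4 G6 e_add algebra_simps)
    finally show ?case by simp
  qed
  then show ?thesis using assms(2) by (simp add: G_def e_def)
qed

lemma Gam_letter_flow:
  fixes \<omega> :: "real ^ 'd"
  assumes "nonresonant \<omega>"
  shows "letter_flow (beta \<omega>) (\<lambda>t. Gam \<omega> (\<sigma> + t) (to_torus (t *\<^sub>R \<omega>)) \<theta>\<^sub>0)"
  using Gam_line_derivative[OF assms, where w = "w @ [k]" for w k]
  by (simp add: letter_flow_def beta_letter)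

lemma Gam_line_initial:
  fixes \<omega> :: "real ^ 'd"
  shows "Gam \<omega> (- t\<^sub>0 + t\<^sub>0) (to_torus (t\<^sub>0 *\<^sub>R \<omega>)) (to_torus (t\<^sub>0 *\<^sub>R \<omega>)) = conv_one"
  by (simp add: Gam_initial)

text \<open>The shuffle relations hold on the line by \<open>letter_flow_shuffle\<close> and extend from it.\<close>

lemma Gam_shuffle_group:
  fixes \<omega> :: "real ^ 'd"
  assumes nr: "nonresonant \<omega>"
  shows "Gam \<omega> \<tau> \<theta> (to_torus (t\<^sub>0 *\<^sub>R \<omega>)) \<in> shuffle_group"
proof -
  define G where "G = (\<lambda>w \<tau> \<theta>. Gam \<omega> \<tau> \<theta> (to_torus (t\<^sub>0 *\<^sub>R \<omega>)) w)"
  have "G w \<tau> \<theta> * G w' \<tau> \<theta> - (\<Sum>u\<in>#shuffle_mset w w'. G u \<tau> \<theta>) = 0" for w w'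
  proof (rule exp_poly_zero_on_line[OF nr])
    show "exp_poly (\<lambda>\<tau> \<theta>. G w \<tau> \<theta> * G w' \<tau> \<theta> - (\<Sum>u\<in>#shuffle_mset w w'. G u \<tau> \<theta>))"
      unfolding G_def by (intro exp_poly_diff exp_poly_mult exp_poly_sum_mset Gam_exp_poly)
    show "G w (t - t\<^sub>0) (to_torus (t *\<^sub>R \<omega>)) * G w' (t - t\<^sub>0) (to_torus (t *\<^sub>R \<omega>)) -
        (\<Sum>u\<in>#shuffle_mset w w'. G u (t - t\<^sub>0) (to_torus (t *\<^sub>R \<omega>))) = 0" for t
      using letter_flow_shuffle[OF Gam_letter_flow[OF nr] Gam_line_initial, of t\<^sub>0 t]
      by (simp add: shuffle_group_def G_def)
  qed
  then show ?thesis by (simp add: shuffle_group_def G_def)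
qed

lemma letter_flow_conv_left:
  assumes "letter_flow b a"
  shows "letter_flow b (\<lambda>t. \<gamma> \<star> a t)"
  unfolding letter_flow_def
proof (intro allI conjI)
  have a0: "((\<lambda>s. a s []) has_vector_derivative 0) (at t)" for t
    using assms by (simp add: letter_flow_def)
  have a1: "((\<lambda>s. a s (w @ [k])) has_vector_derivative a t w * b t [k]) (at t)" for t w k
    using assms by (simp add: letter_flow_def)
  fix t
  show "((\<lambda>s. (\<gamma> \<star> a s) []) has_vector_derivative 0) (at t)"
    using has_vector_derivative_mult_right[OF a0, of "\<gamma> []"] by (simp add: conv_def)
  fix w k
  have "((\<lambda>s. (\<Sum>j\<le>length w. \<gamma> (take j w) * a s (drop j w @ [k])) + \<gamma> (w @ [k]) * a s [])
      has_vector_derivative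
        ((\<Sum>j\<le>length w. \<gamma> (take j w) * (a t (drop j w) * b t [k])) + \<gamma> (w @ [k]) * 0)) (at t)"
    by (intro has_vector_derivative_add has_vector_derivative_sum has_vector_derivative_mult_right a0 a1)
  then show "((\<lambda>s. (\<gamma> \<star> a s) (w @ [k])) has_vector_derivative (\<gamma> \<star> a t) w * b t [k]) (at t)"
    unfolding conv_snoc by (simp add: conv_def sum_distrib_right mult.assoc)
qed

text \<open>On the line both sides solve \<open>a' = a \<star> \<beta>(t)\<close> and equal
  \<open>\<Gamma>(\<sigma>, \<theta>\<^sub>0; \<theta>\<^sub>0)\<close> at \<open>t\<^sub>0\<close>; the identity then extends to all \<open>\<tau>\<close> and \<open>\<theta>\<close> with
  \<open>\<sigma>\<close> fixed.\<close>

lemma Gam_factor: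
  fixes \<omega> :: "real ^ 'd"
  assumes nr: "nonresonant \<omega>" and \<theta>\<^sub>0: "\<theta>\<^sub>0 = to_torus (t\<^sub>0 *\<^sub>R \<omega>)"
  shows "Gam \<omega> (\<sigma> + \<tau>) \<theta> \<theta>\<^sub>0 = Gam \<omega> \<sigma> \<theta>\<^sub>0 \<theta>\<^sub>0 \<star> Gam \<omega> \<tau> \<theta> \<theta>\<^sub>0"
proof
  fix w :: "(int ^ 'd) list"
  have line: "(\<lambda>t. Gam \<omega> (\<sigma> - t\<^sub>0 + t) (to_torus (t *\<^sub>R \<omega>)) \<theta>\<^sub>0) =
      (\<lambda>t. Gam \<omega> \<sigma> \<theta>\<^sub>0 \<theta>\<^sub>0 \<star> Gam \<omega> (- t\<^sub>0 + t) (to_torus (t *\<^sub>R \<omega>)) \<theta>\<^sub>0)"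
  proof (rule letter_flow_unique)
    show "Gam \<omega> (\<sigma> - t\<^sub>0 + t\<^sub>0) (to_torus (t\<^sub>0 *\<^sub>R \<omega>)) \<theta>\<^sub>0 =
        Gam \<omega> \<sigma> \<theta>\<^sub>0 \<theta>\<^sub>0 \<star> Gam \<omega> (- t\<^sub>0 + t\<^sub>0) (to_torus (t\<^sub>0 *\<^sub>R \<omega>)) \<theta>\<^sub>0"
      using Gam_line_initial[of \<omega> t\<^sub>0] by (simp add: \<theta>\<^sub>0 conv_one_right)
    show "letter_flow (beta \<omega>) (\<lambda>t. Gam \<omega> (\<sigma> - t\<^sub>0 + t) (to_torus (t *\<^sub>R \<omega>)) \<theta>\<^sub>0)"
      by (rule Gam_letter_flow[OF nr])
    show "letter_flow (beta \<omega>)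
        (\<lambda>t. Gam \<omega> \<sigma> \<theta>\<^sub>0 \<theta>\<^sub>0 \<star> Gam \<omega> (- t\<^sub>0 + t) (to_torus (t *\<^sub>R \<omega>)) \<theta>\<^sub>0)"
      by (intro letter_flow_conv_left Gam_letter_flow nr)
  qed
  define f where "f = (\<lambda>\<tau> \<theta>. Gam \<omega> (\<sigma> + \<tau>) \<theta> \<theta>\<^sub>0 w - (Gam \<omega> \<sigma> \<theta>\<^sub>0 \<theta>\<^sub>0 \<star> Gam \<omega> \<tau> \<theta> \<theta>\<^sub>0) w)"
  have "f \<tau> \<theta> = 0"
  proof (rule exp_poly_zero_on_line[OF nr])
    show "exp_poly f"
      unfolding f_def conv_def
      by (intro exp_poly_diff exp_poly_sum exp_poly_mult[OF exp_poly_const] Gam_exp_poly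
          exp_poly_shift[OF Gam_exp_poly])
    show "f (t - t\<^sub>0) (to_torus (t *\<^sub>R \<omega>)) = 0" for t
      using fun_cong[OF line, of t] by (simp add: f_def algebra_simps)
  qed
  then show "Gam \<omega> (\<sigma> + \<tau>) \<theta> \<theta>\<^sub>0 w = (Gam \<omega> \<sigma> \<theta>\<^sub>0 \<theta>\<^sub>0 \<star> Gam \<omega> \<tau> \<theta> \<theta>\<^sub>0) w"
    by (simp add: f_def)
qed

section \<open>One-parameter subgroups and averaging\<close>

text \<open>The product of the values at two nonempty words vanishes to second order where the curve
  passes through the unit, so the derivative of the shuffle relation has left-hand side zero.\<close>

lemma shuffle_group_tangent:
  assumes "\<And>s. g s \<in> shuffle_group" and init: "g t\<^sub>0 = conv_one"
    and deriv: "has_word_derivative g \<beta> t\<^sub>0"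
  shows "\<beta> \<in> shuffle_lie"
proof -
  have g: "g s [] = 1" "g s w * g s w' = (\<Sum>u\<in>#shuffle_mset w w'. g s u)" for s w w'
    using assms(1)[of s] by (auto simp: shuffle_group_def)
  have d: "((\<lambda>s. g s w) has_vector_derivative \<beta> w) (at t\<^sub>0)" for w
    using deriv by (simp add: has_word_derivative_def)
  have "\<beta> [] = 0"
    using d[of "[]"] unfolding g(1)
    by (rule vector_derivative_unique_at[OF _ has_vector_derivative_const])
  moreover have "(\<Sum>u\<in>#shuffle_mset w w'. \<beta> u) = 0" if "w \<noteq> []" "w' \<noteq> []" for w w'
  proof -
    have "((\<lambda>s. g s w * g s w') has_vector_derivative (\<Sum>u\<in>#shuffle_mset w w'. \<beta> u)) (at t\<^sub>0)"
      unfolding g(2) by (intro has_vector_derivative_sum_mset d)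
    moreover have "((\<lambda>s. g s w * g s w') has_vector_derivative 0) (at t\<^sub>0)"
      using has_vector_derivative_mult[OF d[of w] d[of w']] that by (simp add: init conv_one_def)
    ultimately show ?thesis by (rule vector_derivative_unique_at)
  qed
  ultimately show ?thesis by (simp add: shuffle_lie_def)
qed

lemma one_parameter_group_ivp:
  assumes group: "\<And>s \<tau>. g (s + \<tau>) = g s \<star> g \<tau>" and init: "g 0 = conv_one"
    and deriv: "has_word_derivative g \<beta> 0"
  shows "solves_ivp (\<lambda>_. \<beta>) t\<^sub>0 (\<lambda>t. g (t - t\<^sub>0))"
proof -
  have "((\<lambda>s. g (s - t\<^sub>0) w) has_vector_derivative (g (t - t\<^sub>0) \<star> \<beta>) w) (at t)" for t w
  proof -
    have "((\<lambda>\<tau>. (g (t - t\<^sub>0) \<star> g \<tau>) w) has_vector_derivative (g (t - t\<^sub>0) \<star> \<beta>) w) (at 0)"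
      unfolding conv_def using deriv
      by (intro has_vector_derivative_sum has_vector_derivative_mult_right)
        (simp add: has_word_derivative_def)
    then have "((\<lambda>\<tau>. g (t - t\<^sub>0 + \<tau>) w) has_vector_derivative (g (t - t\<^sub>0) \<star> \<beta>) w) (at (t - t))"
      by (simp add: group)
    moreover have "((\<lambda>s. s - t) has_vector_derivative 1) (at t)"
      by (auto intro!: derivative_eq_intros)
    ultimately show ?thesis
      using vector_diff_chain_at[of "\<lambda>s. s - t" 1 t "\<lambda>\<tau>. g (t - t\<^sub>0 + \<tau>) w"
          "(g (t - t\<^sub>0) \<star> \<beta>) w"] by (simp add: comp_def)
  qed
  then show ?thesis by (simp add: solves_ivp_def init has_word_derivative_def)
qed

theorem theorem4:
  fixes \<omega> :: "real ^ 'd" and t\<^sub>0 :: real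
  assumes "nonresonant \<omega>"
  shows "(\<forall>\<theta>. kappa \<omega> \<theta> t\<^sub>0 \<in> shuffle_group) \<and>
    (\<exists>!\<alpha>. solves_ivp (beta \<omega>) t\<^sub>0 \<alpha>) \<and>
    (\<forall>\<alpha>. solves_ivp (beta \<omega>) t\<^sub>0 \<alpha> \<longrightarrow>
      (\<forall>t. \<alpha> t \<in> shuffle_group) \<and>
      (\<exists>\<alpha>bar \<beta>bar.
        (\<forall>t. \<alpha> t = \<alpha>bar t \<star> kappa \<omega> (to_torus (t *\<^sub>R \<omega>)) t\<^sub>0) \<and>
        solves_ivp (\<lambda>_. \<beta>bar) t\<^sub>0 \<alpha>bar \<and>
        has_word_derivative \<alpha>bar \<beta>bar t\<^sub>0 \<and>
        \<beta>bar \<in> shuffle_lie \<and>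
        (\<forall>t. \<alpha>bar t = Gam \<omega> (t - t\<^sub>0) (to_torus (t\<^sub>0 *\<^sub>R \<omega>)) (to_torus (t\<^sub>0 *\<^sub>R \<omega>)))))"
proof -
  define \<theta>\<^sub>0 where "\<theta>\<^sub>0 = to_torus (t\<^sub>0 *\<^sub>R \<omega>)"
  define A where "A = (\<lambda>t. Gam \<omega> (- t\<^sub>0 + t) (to_torus (t *\<^sub>R \<omega>)) \<theta>\<^sub>0)"
  define g where "g = (\<lambda>\<tau>. Gam \<omega> \<tau> \<theta>\<^sub>0 \<theta>\<^sub>0)"
  define \<beta>bar where "\<beta>bar = (\<lambda>w. vector_derivative (\<lambda>\<tau>. g \<tau> w) (at 0))"
  have ivp: "solves_ivp (beta \<omega>) t\<^sub>0 a \<longleftrightarrow> a t\<^sub>0 = conv_one \<and> letter_flow (beta \<omega>) a" for a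
    unfolding solves_ivp_def by (subst letter_flow_iff) (auto intro: beta_nonletter)
  have A: "solves_ivp (beta \<omega>) t\<^sub>0 A"
    unfolding ivp A_def \<theta>\<^sub>0_def using Gam_line_initial Gam_letter_flow[OF assms] by blast
  have unique: "\<alpha> = A" if "solves_ivp (beta \<omega>) t\<^sub>0 \<alpha>" for \<alpha>
    using that A letter_flow_unique[of "beta \<omega>" \<alpha> A t\<^sub>0] by (simp add: ivp)
  have g0: "g 0 = conv_one" by (simp add: g_def Gam_initial)
  have group: "g (s + \<tau>) = g s \<star> g \<tau>" for s \<tau>
    unfolding g_def using assms \<theta>\<^sub>0_def by (rule Gam_factor)
  have deriv: "has_word_derivative g \<beta>bar 0"
    unfolding has_word_derivative_def \<beta>bar_def g_def
    using exp_poly_differentiable[OF Gam_exp_poly] vector_derivative_works by blast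
  have lie: "\<beta>bar \<in> shuffle_lie"
    using shuffle_group_tangent[OF _ g0 deriv] Gam_shuffle_group[OF assms]
    by (simp add: g_def \<theta>\<^sub>0_def)
  have bar: "solves_ivp (\<lambda>_. \<beta>bar) t\<^sub>0 (\<lambda>t. g (t - t\<^sub>0))"
    using group g0 deriv by (rule one_parameter_group_ivp)
  have bar': "has_word_derivative (\<lambda>t. g (t - t\<^sub>0)) \<beta>bar t\<^sub>0"
  proof -
    have "has_word_derivative (\<lambda>t. g (t - t\<^sub>0)) (g (t\<^sub>0 - t\<^sub>0) \<star> \<beta>bar) t\<^sub>0"
      using bar unfolding solves_ivp_def by blast
    then show ?thesis by (simp only: diff_self g0 conv_one_left)
  qed
  have factor: "A t = g (t - t\<^sub>0) \<star> kappa \<omega> (to_torus (t *\<^sub>R \<omega>)) t\<^sub>0" for t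
    using Gam_factor[OF assms \<theta>\<^sub>0_def, of "t - t\<^sub>0" 0 "to_torus (t *\<^sub>R \<omega>)"]
    by (simp add: A_def g_def kappa_def \<theta>\<^sub>0_def)
  have in_group: "Gam \<omega> \<tau> \<theta> \<theta>\<^sub>0 \<in> shuffle_group" for \<tau> \<theta>
    unfolding \<theta>\<^sub>0_def by (rule Gam_shuffle_group[OF assms])
  show ?thesis
  proof (intro conjI allI impI)
    show "kappa \<omega> \<theta> t\<^sub>0 \<in> shuffle_group" for \<theta>
      using in_group by (simp add: kappa_def \<theta>\<^sub>0_def)
    show "\<exists>!\<alpha>. solves_ivp (beta \<omega>) t\<^sub>0 \<alpha>"
      using A unique by (rule ex1I)
    fix \<alpha> assume "solves_ivp (beta \<omega>) t\<^sub>0 \<alpha>"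
    then have \<alpha>: "\<alpha> = A" by (rule unique)
    show "\<alpha> t \<in> shuffle_group" for t
      using in_group by (simp add: \<alpha> A_def)
    show "\<exists>\<alpha>bar \<beta>bar.
        (\<forall>t. \<alpha> t = \<alpha>bar t \<star> kappa \<omega> (to_torus (t *\<^sub>R \<omega>)) t\<^sub>0) \<and>
        solves_ivp (\<lambda>_. \<beta>bar) t\<^sub>0 \<alpha>bar \<and>
        has_word_derivative \<alpha>bar \<beta>bar t\<^sub>0 \<and>
        \<beta>bar \<in> shuffle_lie \<and>
        (\<forall>t. \<alpha>bar t = Gam \<omega> (t - t\<^sub>0) (to_torus (t\<^sub>0 *\<^sub>R \<omega>)) (to_torus (t\<^sub>0 *\<^sub>R \<omega>)))"
    proof (intro exI conjI allI)
      show "\<alpha> t = g (t - t\<^sub>0) \<star> kappa \<omega> (to_torus (t *\<^sub>R \<omega>)) t\<^sub>0" for t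
        unfolding \<alpha> by (rule factor)
      show "g (t - t\<^sub>0) = Gam \<omega> (t - t\<^sub>0) (to_torus (t\<^sub>0 *\<^sub>R \<omega>)) (to_torus (t\<^sub>0 *\<^sub>R \<omega>))" for t
        by (simp add: g_def \<theta>\<^sub>0_def)
    qed (fact bar bar' lie)+
  qed
qed

end
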